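(* For every positive integer $n$ with $n\equiv 0 \pmod 4$, there exists a pair of orthogonal Latin squares $A=(a_{ij})$, $B=(b_{ij})$ of order $n$ such that each of $A$ and $B$ has main diagonal sum $n(n+1)/2$ and antidiagonal sum $n(n+1)/2$; that is, $\sum_{i=1}^n a_{ii}=\sum_{i=1}^n b_{ii}=\sum_{i=1}^n a_{i(n+1-i)}=\sum_{i=1}^n b_{i(n+1-i)}=\frac{n(n+1)}{2}$.
   Context: A Latin square of order $n$ is an $n\times n$ array with entries in $\{1,\dots,n\}$ in which each symbol occurs exactly once in each row and each column. Two Latin squares $(a_{ij})$, $(b_{ij})$ of order $n$ are orthogonal if the $n^2$ ordered pairs $(a_{ij},b_{ij})$ are all distinct. *)

theory Defs
  imports Main
begin

(* Arrays are indexed by {1..n} in both coordinates, A i j being the entry in row i and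
   column j; values outside {1..n} x {1..n} are irrelevant. *)

definition latin_square :: "nat \<Rightarrow> (nat \<Rightarrow> nat \<Rightarrow> nat) \<Rightarrow> bool" where
  "latin_square n A \<longleftrightarrow>
     (\<forall>i\<in>{1..n}. \<forall>j\<in>{1..n}. A i j \<in> {1..n}) \<and>
     (\<forall>i\<in>{1..n}. \<forall>s\<in>{1..n}. \<exists>!j. j \<in> {1..n} \<and> A i j = s) \<and>
     (\<forall>j\<in>{1..n}. \<forall>s\<in>{1..n}. \<exists>!i. i \<in> {1..n} \<and> A i j = s)"

definition orthogonal_latin_squares ::
    "nat \<Rightarrow> (nat \<Rightarrow> nat \<Rightarrow> nat) \<Rightarrow> (nat \<Rightarrow> nat \<Rightarrow> nat) \<Rightarrow> bool" where
  "orthogonal_latin_squares n A B \<longleftrightarrow>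
     latin_square n A \<and> latin_square n B \<and>
     inj_on (\<lambda>(i, j). (A i j, B i j)) ({1..n} \<times> {1..n})"

end

(* Balanced pairs (both diagonal sums correct) are closed under direct products: index and
   symbol are read in mixed radix, so the diagonals of the product are the products of the
   diagonals. Multiplication tables x + a y over GF(4) and GF(8) with a distinct from 0 and 1
   give orders 4 and 8. For odd order 2k+1, i + j + k + 1 over the integers modulo 2k+1 has
   a permutation as diagonal and the constant k as antidiagonal, and it is orthogonal to its
   mirror image. Every multiple of 4 is a product of 4s, 8s and one odd number. *)

theory Submission
  imports Defs
begin

text \<open>Indices and symbols start at 0. The sums are required to be \<open>n * (n - 1) div 2\<close>,
  written without subtraction or division.\<close>

definition balanced_latin :: "nat \<Rightarrow> (nat \<Rightarrow> nat \<Rightarrow> nat) \<Rightarrow> bool" where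
  "balanced_latin n A \<longleftrightarrow>
     (\<forall>i<n. \<forall>j<n. A i j < n) \<and>
     (\<forall>i<n. inj_on (A i) {..<n}) \<and>
     (\<forall>j<n. inj_on (\<lambda>i. A i j) {..<n}) \<and>
     2 * (\<Sum>i<n. A i i) + n = n * n \<and>
     2 * (\<Sum>i<n. A i (n - Suc i)) + n = n * n"

definition balanced_mols ::
    "nat \<Rightarrow> (nat \<Rightarrow> nat \<Rightarrow> nat) \<Rightarrow> (nat \<Rightarrow> nat \<Rightarrow> nat) \<Rightarrow> bool" where
  "balanced_mols n A B \<longleftrightarrow>
     balanced_latin n A \<and> balanced_latin n B \<and>
     inj_on (\<lambda>(i, j). (A i j, B i j)) ({..<n} \<times> {..<n})"

section \<open>Direct products of balanced pairs\<close>

definition kron :: "nat \<Rightarrow> (nat \<Rightarrow> nat \<Rightarrow> nat) \<Rightarrow> (nat \<Rightarrow> nat \<Rightarrow> nat) \<Rightarrow> nat \<Rightarrow> nat \<Rightarrow> nat" where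
  "kron b A C i j = b * A (i div b) (j div b) + C (i mod b) (j mod b)"

lemma mixed_radix_eqD:
  fixes b :: nat
  assumes "b * u + v = b * u' + v'" "v < b" "v' < b"
  shows "u = u'" "v = v'"
proof -
  have "(b * u + v) div b = (b * u' + v') div b" "(b * u + v) mod b = (b * u' + v') mod b"
    using assms(1) by simp_all
  then show "u = u'" "v = v'"
    using assms(2,3) by simp_all
qed

lemma mixed_radix_less:
  fixes b :: nat
  assumes "u < a" "v < b"
  shows "b * u + v < a * b"
proof -
  have "b * u + v < b * Suc u"
    using assms(2) by simp
  also have "\<dots> \<le> b * a"
    using assms(1) by (intro mult_le_mono2) simp
  finally show ?thesis
    by (simp add: mult.commute)
qed

text \<open>The map acts separately on the quotient and the remainder of \<open>i\<close> by
  \<open>b\<close>. The bound on \<open>g\<close> prevents carries, so both output digits can be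
  read off again.\<close>

lemma inj_on_mixed_radix:
  fixes f g :: "nat \<Rightarrow> nat"
  assumes f: "inj_on f {..<a}" and g: "inj_on g {..<b}" and "\<And>i. i < b \<Longrightarrow> g i < b"
  shows "inj_on (\<lambda>i. b * f (i div b) + g (i mod b)) {..<a * b}"
proof (rule inj_onI)
  fix x y
  assume x: "x \<in> {..<a * b}" and y: "y \<in> {..<a * b}"
    and eq: "b * f (x div b) + g (x mod b) = b * f (y div b) + g (y mod b)"
  have b: "b > 0"
    using x by (cases b) auto
  have bounds: "x div b < a" "y div b < a" "x mod b < b" "y mod b < b"
    using x y b by (simp_all add: less_mult_imp_div_less)
  have "f (x div b) = f (y div b)" "g (x mod b) = g (y mod b)"
    using mixed_radix_eqD[OF eq] bounds assms(3) by simp_all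
  then have "x div b = y div b" "x mod b = y mod b"
    using bounds by (auto intro: inj_onD[OF f] inj_onD[OF g])
  then show "x = y"
    by (metis div_mult_mod_eq)
qed

text \<open>Each quotient below \<open>a\<close> meets each remainder below \<open>b\<close> exactly
  once: every high digit is counted \<open>b\<close> times with weight \<open>b\<close>, every low
  digit \<open>a\<close> times.\<close>

lemma sum_mixed_radix:
  fixes f g :: "nat \<Rightarrow> nat"
  shows "(\<Sum>i<a * b. b * f (i div b) + g (i mod b)) = b * b * (\<Sum>i<a. f i) + a * (\<Sum>i<b. g i)"
proof -
  have "(\<Sum>i<a * b. b * f (i div b) + g (i mod b))
      = (\<Sum>x<a. \<Sum>i\<in>{x * b..<x * b + b}. b * f (i div b) + g (i mod b))"
    by (rule sum.nat_group[symmetric])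
  also have "\<dots> = (\<Sum>x<a. b * b * f x + (\<Sum>i<b. g i))"
  proof (rule sum.cong[OF refl])
    fix x
    have "(\<Sum>i\<in>{x * b..<x * b + b}. b * f (i div b) + g (i mod b))
        = (\<Sum>i<b. b * f ((i + x * b) div b) + g ((i + x * b) mod b))"
      using sum.shift_bounds_nat_ivl[of "\<lambda>i. b * f (i div b) + g (i mod b)" 0 "x * b" b]
      by (simp add: lessThan_atLeast0 add.commute)
    also have "\<dots> = (\<Sum>i<b. b * f x + g i)"
      by (intro sum.cong) auto
    finally show "(\<Sum>i\<in>{x * b..<x * b + b}. b * f (i div b) + g (i mod b))
        = b * b * f x + (\<Sum>i<b. g i)"
      by (simp add: sum.distrib)
  qed
  finally show ?thesis
    by (simp add: sum.distrib sum_distrib_left)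
qed

text \<open>The number \<open>a * b - 1\<close> has the maximal digits \<open>a - 1\<close> and
  \<open>b - 1\<close>, so subtracting \<open>i\<close> from it borrows nothing and complements each
  digit. This turns the antidiagonal of a product into the antidiagonals of its factors.\<close>

lemma mixed_radix_complement:
  fixes a b i :: nat
  assumes "i < a * b"
  shows "(a * b - Suc i) div b = a - Suc (i div b)" "(a * b - Suc i) mod b = b - Suc (i mod b)"
proof -
  have b: "b > 0"
    using assms by (cases b) auto
  have "i div b < a"
    using assms by (rule less_mult_imp_div_less)
  then obtain d where d: "a = Suc (i div b) + d"
    using less_iff_Suc_add by auto
  have m: "i mod b < b"
    using b by simp
  have "i = b * (i div b) + i mod b"
    by simp
  then have i: "i = (i div b) * b + i mod b"
    by (simp only: mult.commute)
  obtain e where e: "b = Suc (i mod b) + e"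
    using m less_iff_Suc_add by auto
  have "a * b = (i div b) * b + b + d * b"
    unfolding d by (simp add: distrib_right)
  then have "a * b = Suc i + (d * b + e)"
    using i e by linarith
  then have "a * b - Suc i = d * b + e"
    by simp
  moreover have "e < b" "b - Suc (i mod b) = e"
    using e by linarith+
  ultimately show "(a * b - Suc i) div b = a - Suc (i div b)"
    "(a * b - Suc i) mod b = b - Suc (i mod b)"
    by (simp_all add: d)
qed

lemma balanced_latin_kron:
  assumes A: "balanced_latin a A" and C: "balanced_latin b C"
  shows "balanced_latin (a * b) (kron b A C)"
proof (cases "a * b = 0")
  case True
  show ?thesis
    unfolding balanced_latin_def True by simp
next
  case False
  then have b: "b > 0"
    by simp
  have A_less: "A i j < a" if "i < a" "j < a" for i j
    using A that by (simp add: balanced_latin_def)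
  have C_less: "C i j < b" if "i < b" "j < b" for i j
    using C that by (simp add: balanced_latin_def)
  have range: "kron b A C i j < a * b" if "i < a * b" "j < a * b" for i j
    unfolding kron_def using that b
    by (intro mixed_radix_less A_less C_less) (simp_all add: less_mult_imp_div_less)
  have row: "inj_on (kron b A C i) {..<a * b}" if "i < a * b" for i
    unfolding kron_def using that b A C
    by (intro inj_on_mixed_radix) (simp_all add: less_mult_imp_div_less balanced_latin_def)
  have col: "inj_on (\<lambda>i. kron b A C i j) {..<a * b}" if "j < a * b" for j
    unfolding kron_def using that b A C
    by (intro inj_on_mixed_radix[where f = "\<lambda>i. A i (j div b)" and g = "\<lambda>i. C i (j mod b)"])
      (simp_all add: less_mult_imp_div_less balanced_latin_def)
  \<comment> \<open>Here \<open>s\<close> and \<open>t\<close> stand for the sums along a diagonal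
    of each factor. Adding \<open>b * b * a\<close> to both sides lets the two hypotheses be
    substituted as they are, without subtraction.\<close>
  have count: "2 * (b * b * s + a * t) + a * b = a * b * (a * b)"
    if "2 * s + a = a * a" "2 * t + b = b * b" for s t
  proof -
    have "2 * (b * b * s + a * t) + a * b + b * b * a = b * b * (2 * s + a) + a * (2 * t + b)"
      by (simp add: algebra_simps)
    also have "\<dots> = a * b * (a * b) + b * b * a"
      unfolding that by (simp add: algebra_simps)
    finally show ?thesis
      by simp
  qed
  have "(\<Sum>i<a * b. kron b A C i i) = b * b * (\<Sum>i<a. A i i) + a * (\<Sum>i<b. C i i)"
    unfolding kron_def by (rule sum_mixed_radix)
  then have diag: "2 * (\<Sum>i<a * b. kron b A C i i) + a * b = a * b * (a * b)"
    using A C by (simp only: count balanced_latin_def)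
  have "(\<Sum>i<a * b. kron b A C i (a * b - Suc i))
      = (\<Sum>i<a * b. b * A (i div b) (a - Suc (i div b)) + C (i mod b) (b - Suc (i mod b)))"
    unfolding kron_def by (intro sum.cong) (simp_all add: mixed_radix_complement)
  also have "\<dots> = b * b * (\<Sum>i<a. A i (a - Suc i)) + a * (\<Sum>i<b. C i (b - Suc i))"
    by (rule sum_mixed_radix)
  finally have anti: "2 * (\<Sum>i<a * b. kron b A C i (a * b - Suc i)) + a * b = a * b * (a * b)"
    using A C by (simp only: count balanced_latin_def)
  show ?thesis
    unfolding balanced_latin_def using range row col diag anti by blast
qed

text \<open>A pair of product entries determines its pair of high digits and its pair of low digits.
  Orthogonality of \<open>A\<close> and \<open>B\<close> then recovers the quotients of the cell,
  and that of \<open>C\<close> and \<open>D\<close> its remainders.\<close>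

lemma balanced_mols_kron:
  assumes AB: "balanced_mols a A B" and CD: "balanced_mols b C D"
  shows "balanced_mols (a * b) (kron b A C) (kron b B D)"
proof -
  have "inj_on (\<lambda>(i, j). (kron b A C i j, kron b B D i j)) ({..<a * b} \<times> {..<a * b})"
  proof (rule inj_onI, clarify)
    fix i j i' j'
    assume i: "i < a * b" "i' < a * b" and j: "j < a * b" "j' < a * b"
      and eq: "kron b A C i j = kron b A C i' j'" "kron b B D i j = kron b B D i' j'"
    have b: "b > 0"
      using i by (cases b) auto
    have q: "i div b < a" "i' div b < a" "j div b < a" "j' div b < a"
      using i j by (simp_all add: less_mult_imp_div_less)
    have r: "i mod b < b" "i' mod b < b" "j mod b < b" "j' mod b < b"
      using b by simp_all
    have less: "C (i mod b) (j mod b) < b" "C (i' mod b) (j' mod b) < b"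
      "D (i mod b) (j mod b) < b" "D (i' mod b) (j' mod b) < b"
      using CD r by (simp_all add: balanced_mols_def balanced_latin_def)
    note e1 = mixed_radix_eqD[OF eq(1)[unfolded kron_def] less(1,2)]
    note e2 = mixed_radix_eqD[OF eq(2)[unfolded kron_def] less(3,4)]
    have "(i div b, j div b) = (i' div b, j' div b)"
      using AB e1(1) e2(1) q unfolding balanced_mols_def
      by (elim conjE inj_onD) auto
    moreover have "(i mod b, j mod b) = (i' mod b, j' mod b)"
      using CD e1(2) e2(2) r unfolding balanced_mols_def
      by (elim conjE inj_onD) auto
    ultimately show "i = i' \<and> j = j'"
      by (metis div_mult_mod_eq prod.inject)
  qed
  then show ?thesis
    using AB CD by (simp add: balanced_mols_def balanced_latin_kron)
qed

section \<open>Odd orders from the integers modulo 2k+1\<close>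

lemma sum_inj_endo:
  fixes f :: "nat \<Rightarrow> nat"
  assumes "inj_on f {..<n}" "\<And>i. i < n \<Longrightarrow> f i < n"
  shows "2 * (\<Sum>i<n. f i) + n = n * n"
proof -
  have "f ` {..<n} = {..<n}"
    using assms by (intro endo_inj_surj) auto
  then have "(\<Sum>i<n. f i) = \<Sum>{..<n}"
    using sum.reindex[OF assms(1), of "\<lambda>i. i"] by simp
  moreover have "2 * \<Sum>{..<n} + n = n * n"
    by (induction n) simp_all
  ultimately show ?thesis
    by simp
qed

lemma inj_on_reflect: "inj_on f {..<n} \<Longrightarrow> inj_on (\<lambda>i. f (n - Suc i)) {..<n::nat}"
  by (rule inj_onI) (fastforce dest: inj_onD)

text \<open>Reversing the columns exchanges the diagonal and the antidiagonal, and both carry the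
  same sum condition.\<close>

lemma balanced_latin_reflect:
  assumes "balanced_latin n A"
  shows "balanced_latin n (\<lambda>i j. A i (n - Suc j))"
proof -
  have "(\<Sum>i<n. A i (n - Suc (n - Suc i))) = (\<Sum>i<n. A i i)"
    by (intro sum.cong) auto
  then show ?thesis
    using assms by (auto simp: balanced_latin_def intro: inj_on_reflect)
qed

text \<open>Two numbers below \<open>m\<close> differ by less than \<open>m\<close>. Congruences are
  treated as divisibility in \<open>int\<close> so that differences are not truncated.\<close>

lemma dvd_diff_imp_eq:
  fixes i j m :: nat
  assumes "int m dvd int i - int j" "i < m" "j < m"
  shows "i = j"
  using assms by (metis mod_eq_dvd_iff mod_less of_nat_eq_iff zmod_int)

lemma mod_eq_imp_int_dvd:
  "x mod m = y mod m \<Longrightarrow> int m dvd int x - int y" for x y m :: nat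
  by (metis mod_eq_dvd_iff zmod_int)

lemma odd_dvd_double:
  fixes x :: int
  assumes "int (2 * k + 1) dvd 2 * x"
  shows "int (2 * k + 1) dvd x"
proof -
  have "coprime (int (2 * k + 1)) 2"
    by simp
  then show ?thesis
    using assms coprime_dvd_mult_right_iff by blast
qed

lemma balanced_mols_odd:
  fixes k :: nat
  defines "m \<equiv> 2 * k + 1"
  defines "A \<equiv> \<lambda>i j. (i + j + k + 1) mod m"
  shows "balanced_mols m A (\<lambda>i j. A i (m - Suc j))"
proof -
  have m: "m > 0"
    by (simp add: m_def)
  have double: "x = y" if "int m dvd 2 * (int x - int y)" "x < m" "y < m" for x y
    using that odd_dvd_double dvd_diff_imp_eq unfolding m_def by blast
  have dvd: "int m dvd (int i + int j) - (int i' + int j')" if "A i j = A i' j'" for i j i' j'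
    using mod_eq_imp_int_dvd[OF that[unfolded A_def]] by (simp add: algebra_simps)
  have row: "inj_on (A i) {..<m}" for i
    by (rule inj_onI) (use dvd dvd_diff_imp_eq in fastforce)
  have col: "inj_on (\<lambda>i. A i j) {..<m}" for j
    by (rule inj_onI) (use dvd dvd_diff_imp_eq in fastforce)
  \<comment> \<open>The diagonal entry is \<open>2 * i + k + 1\<close> modulo the odd number
    \<open>m\<close>; as 2 is invertible, the diagonal is a permutation.\<close>
  have "inj_on (\<lambda>i. A i i) {..<m}"
  proof (rule inj_onI)
    fix x y
    assume "x \<in> {..<m}" "y \<in> {..<m}" "A x x = A y y"
    then show "x = y"
      using dvd[of x x y y] double[of x y] by (simp add: algebra_simps)
  qed
  then have diag: "2 * (\<Sum>i<m. A i i) + m = m * m"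
    using m by (intro sum_inj_endo) (simp_all add: A_def)
  \<comment> \<open>The offset \<open>k + 1\<close> makes the antidiagonal constant with value
    \<open>k\<close>, the mean of 0, ..., 2k, and this gives the required sum.\<close>
  have "A i (m - Suc i) = k" if "i < m" for i
  proof -
    have "i + (m - Suc i) + k + 1 = k + m"
      using that by simp
    then have "A i (m - Suc i) = (k + m) mod m"
      by (simp only: A_def)
    moreover have "k < m"
      by (simp add: m_def)
    ultimately show ?thesis
      by simp
  qed
  then have anti: "2 * (\<Sum>i<m. A i (m - Suc i)) + m = m * m"
    by (simp add: m_def algebra_simps)
  have latin: "balanced_latin m A"
    unfolding balanced_latin_def using row col diag anti m by (simp add: A_def)
  have "inj_on (\<lambda>(i, j). (A i j, A i (m - Suc j))) ({..<m} \<times> {..<m})"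
  proof (rule inj_onI, clarify)
    fix i j i' j'
    assume b: "i < m" "j < m" "i' < m" "j' < m"
      and eq: "A i j = A i' j'" "A i (m - Suc j) = A i' (m - Suc j')"
    \<comment> \<open>Mirroring turns \<open>i + j\<close> into \<open>i - j\<close> up to a
      constant. Adding the two congruences eliminates the columns and leaves twice the difference of
      the rows.\<close>
    have "int m dvd (int i - int j) - (int i' - int j')"
      using dvd[OF eq(2)] b by (simp add: of_nat_diff algebra_simps)
    from dvd_add[OF dvd[OF eq(1)] this] have "int m dvd 2 * (int i - int i')"
      by (simp add: algebra_simps)
    then have "i = i'"
      using double b by blast
    moreover from this have "j = j'"
      using inj_onD[OF row] eq(1) b by simp
    ultimately show "i = i' \<and> j = j'" ..
  qed
  then show ?thesis
    using latin by (simp add: balanced_mols_def balanced_latin_reflect)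
qed

section \<open>Orders 4 and 8 by evaluation of explicit tables\<close>

definition balanced_latin_table :: "nat \<Rightarrow> nat list list \<Rightarrow> bool" where
  "balanced_latin_table n A \<longleftrightarrow>
     (\<forall>i\<in>set [0..<n]. \<forall>j\<in>set [0..<n]. A ! i ! j < n) \<and>
     (\<forall>i\<in>set [0..<n]. distinct (map (\<lambda>j. A ! i ! j) [0..<n])) \<and>
     (\<forall>j\<in>set [0..<n]. distinct (map (\<lambda>i. A ! i ! j) [0..<n])) \<and>
     2 * sum_list (map (\<lambda>i. A ! i ! i) [0..<n]) + n = n * n \<and>
     2 * sum_list (map (\<lambda>i. A ! i ! (n - Suc i)) [0..<n]) + n = n * n"

definition balanced_mols_table :: "nat \<Rightarrow> nat list list \<Rightarrow> nat list list \<Rightarrow> bool" where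
  "balanced_mols_table n A B \<longleftrightarrow>
     balanced_latin_table n A \<and> balanced_latin_table n B \<and>
     distinct (map (\<lambda>(i, j). (A ! i ! j, B ! i ! j)) (List.product [0..<n] [0..<n]))"

text \<open>The table predicate is phrased with lists, \<open>distinct\<close> and
  \<open>sum_list\<close> so that \<open>code_simp\<close> can evaluate it; this lemma transfers the
  outcome to functions.\<close>

lemma balanced_latin_table:
  "balanced_latin_table n A \<Longrightarrow> balanced_latin n (\<lambda>i j. A ! i ! j)"
  unfolding balanced_latin_table_def balanced_latin_def
  by (simp add: distinct_map interv_sum_list_conv_sum_set_nat lessThan_atLeast0)

lemma balanced_mols_table:
  "balanced_mols_table n A B \<Longrightarrow> balanced_mols n (\<lambda>i j. A ! i ! j) (\<lambda>i j. B ! i ! j)"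
  unfolding balanced_mols_table_def balanced_mols_def
  by (simp add: balanced_latin_table distinct_map lessThan_atLeast0)

lemma balanced_mols_4: "\<exists>A B. balanced_mols 4 A B"
proof -
  \<comment> \<open>Elements of GF(4) are written as 2-bit numbers, added by xor, with 2 a root of
    x^2 + x + 1. The entries are i + 2j in \<open>A\<close> and i + 3j in \<open>B\<close>. Since 3
    - i is i xor 3, each diagonal is (1 + a)i plus a constant, where a is 2 or 3, hence a
    permutation.\<close>
  define A :: "nat list list" where "A =
     [[0, 2, 3, 1],
      [1, 3, 2, 0],
      [2, 0, 1, 3],
      [3, 1, 0, 2]]"
  define B :: "nat list list" where "B =
     [[0, 3, 1, 2],
      [1, 2, 0, 3],
      [2, 1, 3, 0],
      [3, 0, 2, 1]]"
  have "balanced_mols_table 4 A B"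
    unfolding A_def B_def by code_simp
  then show ?thesis
    using balanced_mols_table by blast
qed

lemma balanced_mols_8: "\<exists>A B. balanced_mols 8 A B"
proof -
  \<comment> \<open>The same construction in GF(8), with 2 a root of x^3 + x + 1 and again the
    multipliers 2 and 3; now 7 - i is i xor 7.\<close>
  define A :: "nat list list" where "A =
     [[0, 2, 4, 6, 3, 1, 7, 5],
      [1, 3, 5, 7, 2, 0, 6, 4],
      [2, 0, 6, 4, 1, 3, 5, 7],
      [3, 1, 7, 5, 0, 2, 4, 6],
      [4, 6, 0, 2, 7, 5, 3, 1],
      [5, 7, 1, 3, 6, 4, 2, 0],
      [6, 4, 2, 0, 5, 7, 1, 3],
      [7, 5, 3, 1, 4, 6, 0, 2]]"
  define B :: "nat list list" where "B =
     [[0, 3, 6, 5, 7, 4, 1, 2],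
      [1, 2, 7, 4, 6, 5, 0, 3],
      [2, 1, 4, 7, 5, 6, 3, 0],
      [3, 0, 5, 6, 4, 7, 2, 1],
      [4, 7, 2, 1, 3, 0, 5, 6],
      [5, 6, 3, 0, 2, 1, 4, 7],
      [6, 5, 0, 3, 1, 2, 7, 4],
      [7, 4, 1, 2, 0, 3, 6, 5]]"
  have "balanced_mols_table 8 A B"
    unfolding A_def B_def by code_simp
  then show ?thesis
    using balanced_mols_table by blast
qed

section \<open>All positive multiples of 4\<close>

lemma balanced_mols_exists:
  assumes "n > 0" "4 dvd n"
  shows "\<exists>A B. balanced_mols n A B"
  using assms
proof (induction n rule: less_induct)
  case (less n)
  have odd: "\<exists>A B. balanced_mols m A B" if "odd m" for m
    using that by (elim oddE) (blast intro: balanced_mols_odd)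
  have times: "\<exists>A B. balanced_mols (a * b) A B"
    if "\<exists>A B. balanced_mols a A B" "\<exists>A B. balanced_mols b A B" for a b
    using that balanced_mols_kron by blast
  obtain m where m: "n = 4 * m"
    using less.prems by blast
  \<comment> \<open>Splitting off factors 4 ends at a cofactor that is odd (possibly 1) or twice an
    odd number. No orthogonal pair of order 2 exists, so in the latter case the 2 is merged with the
    4 into a factor 8.\<close>
  consider "odd m" | l where "m = 2 * l" "odd l" | "4 dvd m"
  proof (cases "even m")
    case True
    then obtain l where "m = 2 * l"
      by blast
    then show ?thesis
      using that(2,3) by (cases "odd l") auto
  qed (use that(1) in blast)
  then show ?case
  proof cases
    case 1
    then show ?thesis
      unfolding m by (intro times balanced_mols_4 odd)
  next
    case 2
    then have "n = 8 * l"
      by (simp add: m)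
    then show ?thesis
      using times[OF balanced_mols_8 odd] 2 by simp
  next
    case 3
    then show ?thesis
      using less.IH[of m] less.prems times[OF balanced_mols_4] by (simp add: m)
  qed
qed

section \<open>Passing to indices and symbols that start at 1\<close>

lemma bex1_preimage:
  fixes f :: "nat \<Rightarrow> nat"
  assumes inj: "inj_on f {..<n}" and less: "\<And>i. i < n \<Longrightarrow> f i < n" and s: "s \<in> {1..n}"
  shows "\<exists>!i. i \<in> {1..n} \<and> Suc (f (i - 1)) = s"
proof -
  \<comment> \<open>An injective self-map of a finite set is onto; this supplies the existence of a
    cell with the symbol \<open>s\<close>, while injectivity gives uniqueness.\<close>
  have "f ` {..<n} = {..<n}"
    using inj less by (intro endo_inj_surj) auto
  moreover have "s - 1 \<in> {..<n}"
    using s by auto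
  ultimately obtain i where i: "i < n" "f i = s - 1"
    by (metis imageE lessThan_iff)
  show ?thesis
  proof (rule ex1I[of _ "Suc i"])
    show "Suc i \<in> {1..n} \<and> Suc (f (Suc i - 1)) = s"
      using i s by simp
  next
    fix j
    assume j: "j \<in> {1..n} \<and> Suc (f (j - 1)) = s"
    then have "f (j - 1) = f i" "j - 1 < n"
      using i by auto
    then have "j - 1 = i"
      using i inj_onD[OF inj] by simp
    then show "j = Suc i"
      using j by auto
  qed
qed

lemma balanced_latin_imp_latin_square:
  assumes "balanced_latin n A"
  shows "latin_square n (\<lambda>i j. Suc (A (i - 1) (j - 1)))"
proof -
  have less: "A i j < n" if "i < n" "j < n" for i j
    using assms that by (simp add: balanced_latin_def)
  have p: "i - 1 < n" if "i \<in> {1..n}" for i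
    using that by auto
  show ?thesis
    unfolding latin_square_def
  proof (intro conjI ballI)
    fix i j
    assume "i \<in> {1..n}" "j \<in> {1..n}"
    then show "Suc (A (i - 1) (j - 1)) \<in> {1..n}"
      using less[OF p p] by (simp add: Suc_le_eq)
  next
    fix i s
    assume "i \<in> {1..n}" "s \<in> {1..n}"
    then show "\<exists>!j. j \<in> {1..n} \<and> Suc (A (i - 1) (j - 1)) = s"
      using assms p by (intro bex1_preimage) (simp_all add: balanced_latin_def)
  next
    fix j s
    assume "j \<in> {1..n}" "s \<in> {1..n}"
    then show "\<exists>!i. i \<in> {1..n} \<and> Suc (A (i - 1) (j - 1)) = s"
      using assms p by (intro bex1_preimage[where f = "\<lambda>i. A i (j - 1)"])
        (simp_all add: balanced_latin_def)
  qed
qed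

text \<open>Raising \<open>n\<close> symbols by 1 adds \<open>n\<close>, and n(n-1)/2 + n =
  n(n+1)/2.\<close>

lemma sum_Suc_shift:
  fixes f g :: "nat \<Rightarrow> nat"
  assumes "2 * (\<Sum>i<n. f i) + n = n * n" "\<And>i. i < n \<Longrightarrow> g (Suc i) = Suc (f i)"
  shows "(\<Sum>i=1..n. g i) = n * (n + 1) div 2"
proof -
  have "(\<Sum>i=1..n. g i) = (\<Sum>i<n. g (Suc i))"
    by (simp add: sum.atLeast1_atMost_eq)
  also have "\<dots> = (\<Sum>i<n. f i) + n"
    by (simp add: assms(2) sum_Suc)
  finally have "n * (n + 1) = (\<Sum>i=1..n. g i) * 2"
    using assms(1) by simp
  then show ?thesis
    by simp
qed

theorem theorem4p5:
  fixes n :: nat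
  assumes "n > 0" and "n mod 4 = 0"
  shows "\<exists>A B :: nat \<Rightarrow> nat \<Rightarrow> nat.
    orthogonal_latin_squares n A B \<and>
    (\<Sum>i=1..n. A i i) = n * (n + 1) div 2 \<and>
    (\<Sum>i=1..n. B i i) = n * (n + 1) div 2 \<and>
    (\<Sum>i=1..n. A i (n + 1 - i)) = n * (n + 1) div 2 \<and>
    (\<Sum>i=1..n. B i (n + 1 - i)) = n * (n + 1) div 2"
proof -
  obtain A B where AB: "balanced_mols n A B"
    using balanced_mols_exists assms by (meson mod_0_imp_dvd)
  define shift :: "(nat \<Rightarrow> nat \<Rightarrow> nat) \<Rightarrow> nat \<Rightarrow> nat \<Rightarrow> nat"
    where "shift = (\<lambda>A i j. Suc (A (i - 1) (j - 1)))"
  have latin: "latin_square n (shift A)" "latin_square n (shift B)"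
    using AB balanced_latin_imp_latin_square by (simp_all add: balanced_mols_def shift_def)
  have "inj_on (\<lambda>(i, j). (shift A i j, shift B i j)) ({1..n} \<times> {1..n})"
  proof (rule inj_onI, clarify)
    fix i j i' j'
    assume r: "i \<in> {1..n}" "j \<in> {1..n}" "i' \<in> {1..n}" "j' \<in> {1..n}"
      and eq: "shift A i j = shift A i' j'" "shift B i j = shift B i' j'"
    have "(i - 1, j - 1) = (i' - 1, j' - 1)"
      using AB eq r unfolding balanced_mols_def shift_def
      by (elim conjE inj_onD) auto
    \<comment> \<open>The truncated predecessor determines an index only because \<open>r\<close>
      places it at 1 or above.\<close>
    then show "i = i' \<and> j = j'"
      using r by auto
  qed
  then have orth: "orthogonal_latin_squares n (shift A) (shift B)"
    using latin by (simp add: orthogonal_latin_squares_def)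
  \<comment> \<open>At row \<open>Suc i\<close> the antidiagonal column \<open>n + 1 - Suc i\<close>
    is \<open>n - i\<close>, and the predecessor taken in \<open>shift\<close> makes it
    \<open>n - Suc i\<close>, the antidiagonal column counted from 0.\<close>
  have sums: "(\<Sum>i=1..n. shift C i i) = n * (n + 1) div 2"
    "(\<Sum>i=1..n. shift C i (n + 1 - i)) = n * (n + 1) div 2" if "balanced_latin n C" for C
    using that unfolding balanced_latin_def
    by (intro sum_Suc_shift[of "\<lambda>i. C i i"] sum_Suc_shift[of "\<lambda>i. C i (n - Suc i)"];
        simp add: shift_def)+
  show ?thesis
    using orth sums AB by (auto simp: balanced_mols_def)
qed

end
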